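(* For every integer $k\ge 0$ and every $k$-planar graph $G$, $\chi_{pcf}(G)\leq 60k+59$.
   Context: All graphs are finite, simple and undirected. A graph is $k$-planar if it has an embedding (drawing) in the plane such that each edge is involved in at most $k$ crossings. A $c$-colouring is a function $\psi:V(G)\to C$ with $|C|\le c$; it is proper if $\psi(u)\neq\psi(v)$ for every edge $uv$. With $N(v)=\{w: vw\in E(G)\}$, $\psi$ is conflict-free if for every vertex $v$ with $|N(v)|>0$ there is a colour $\alpha$ such that exactly one $w\in N(v)$ has $\psi(w)=\alpha$. The proper conflict-free chromatic number $\chi_{pcf}(G)$ is the minimum $c$ such that $G$ has a proper conflict-free $c$-colouring. *)

theory Defs
  imports "HOL-Analysis.Analysis"
begin

definition simple_graph :: "'a set \<Rightarrow> ('a \<Rightarrow> 'a \<Rightarrow> bool) \<Rightarrow> bool" where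
  "simple_graph V E \<longleftrightarrow> finite V \<and> (\<forall>u v. E u v \<longrightarrow> u \<in> V \<and> v \<in> V)
     \<and> (\<forall>u v. E u v \<longrightarrow> E v u) \<and> (\<forall>v. \<not> E v v)"

definition edges :: "'a set \<Rightarrow> ('a \<Rightarrow> 'a \<Rightarrow> bool) \<Rightarrow> 'a set set" where
  "edges V E = {{u, v} | u v. u \<in> V \<and> v \<in> V \<and> E u v}"

definition nbhd :: "'a set \<Rightarrow> ('a \<Rightarrow> 'a \<Rightarrow> bool) \<Rightarrow> 'a \<Rightarrow> 'a set" where
  "nbhd V E v = {w \<in> V. E v w}"

definition curve_interior :: "(real \<Rightarrow> real^2) \<Rightarrow> (real^2) set" where
  "curve_interior g = g ` {0<..<1}"

definition is_drawing ::
  "'a set \<Rightarrow> ('a \<Rightarrow> 'a \<Rightarrow> bool) \<Rightarrow> ('a \<Rightarrow> real^2) \<Rightarrow> ('a set \<Rightarrow> real \<Rightarrow> real^2) \<Rightarrow> bool" where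
  "is_drawing V E pos crv \<longleftrightarrow> inj_on pos V \<and>
     (\<forall>u v. u \<in> V \<and> v \<in> V \<and> E u v \<longrightarrow>
        arc (crv {u, v}) \<and>
        ((pathstart (crv {u, v}) = pos u \<and> pathfinish (crv {u, v}) = pos v) \<or>
         (pathstart (crv {u, v}) = pos v \<and> pathfinish (crv {u, v}) = pos u)) \<and>
        path_image (crv {u, v}) \<inter> pos ` V = {pos u, pos v})"

definition crossings ::
  "'a set \<Rightarrow> ('a \<Rightarrow> 'a \<Rightarrow> bool) \<Rightarrow> ('a set \<Rightarrow> real \<Rightarrow> real^2) \<Rightarrow> 'a set \<Rightarrow> ('a set \<times> (real^2)) set" where
  "crossings V E crv e = {(f, p). f \<in> edges V E \<and> f \<noteq> e \<and>
       p \<in> curve_interior (crv e) \<and> p \<in> curve_interior (crv f)}"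

definition k_planar :: "nat \<Rightarrow> 'a set \<Rightarrow> ('a \<Rightarrow> 'a \<Rightarrow> bool) \<Rightarrow> bool" where
  "k_planar k V E \<longleftrightarrow> (\<exists>pos crv. is_drawing V E pos crv \<and>
     (\<forall>e \<in> edges V E. finite (crossings V E crv e) \<and> card (crossings V E crv e) \<le> k))"

definition proper_colouring :: "'a set \<Rightarrow> ('a \<Rightarrow> 'a \<Rightarrow> bool) \<Rightarrow> ('a \<Rightarrow> nat) \<Rightarrow> bool" where
  "proper_colouring V E \<psi> \<longleftrightarrow> (\<forall>u v. u \<in> V \<and> v \<in> V \<and> E u v \<longrightarrow> \<psi> u \<noteq> \<psi> v)"

definition conflict_free :: "'a set \<Rightarrow> ('a \<Rightarrow> 'a \<Rightarrow> bool) \<Rightarrow> ('a \<Rightarrow> nat) \<Rightarrow> bool" where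
  "conflict_free V E \<psi> \<longleftrightarrow> (\<forall>v \<in> V. nbhd V E v \<noteq> {} \<longrightarrow>
      (\<exists>\<alpha>. card {w \<in> nbhd V E v. \<psi> w = \<alpha>} = 1))"

definition pcf_colouring :: "'a set \<Rightarrow> ('a \<Rightarrow> 'a \<Rightarrow> bool) \<Rightarrow> nat \<Rightarrow> ('a \<Rightarrow> nat) \<Rightarrow> bool" where
  "pcf_colouring V E c \<psi> \<longleftrightarrow> card (\<psi> ` V) \<le> c \<and> proper_colouring V E \<psi> \<and> conflict_free V E \<psi>"

definition chi_pcf :: "'a set \<Rightarrow> ('a \<Rightarrow> 'a \<Rightarrow> bool) \<Rightarrow> nat" where
  "chi_pcf V E = (LEAST c. \<exists>\<psi>. pcf_colouring V E c \<psi>)"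

end

theory Submission
  imports Defs "HOL-Complex_Analysis.Winding_Numbers"
begin

text \<open>Choose a neighbour \<open>\<pi> v\<close> of every non-isolated vertex \<open>v\<close>. A colouring is proper and
  conflict-free as soon as it is proper for the graph \<open>H\<close> obtained by joining \<open>\<pi> v\<close> to all other
  neighbours of \<open>v\<close>, so it suffices that \<open>H\<close> is degenerate. On a vertex set \<open>S\<close>, the edges of \<open>H\<close>
  contributed by \<open>v \<in> S\<close> are charged to edges of the graph inside \<open>S\<close>; the others, together with
  the edges inside \<open>S\<close>, form the minor that arises by contracting every \<open>v \<notin> S\<close> into \<open>\<pi> v\<close>. Each of its
  edges is drawn along at most two edges of the graph and so meets at most \<open>2 * k\<close> crossing edges;
  hence a fraction \<open>1 / (2 * k + 1)\<close> of its edges can be selected such that edges without a common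
  end are disjoint. Such a drawing has no \<open>K\<^sub>5\<close> minor, and Mader's argument bounds the number of its
  edges by \<open>4 * |S|\<close>. This makes \<open>H\<close> degenerate with degrees below \<open>48 * k + 24\<close>.

  That \<open>K\<^sub>5\<close> cannot be drawn with disjoint independent edges is a parity argument. The winding
  numbers of edges about vertices are, up to integers, differences of the directions from one vertex
  to another. Each pair of independent edges gives a linear relation between the integers, odd
  exactly when the two edges interleave in the order of the vertices; summing over all pairs, every
  integer occurs twice but the number of interleaving pairs is five.\<close>

section \<open>Winding numbers and the parity obstruction for the complete graph on five
  vertices\<close>

lemma winding_number_continuous_log:
  assumes "continuous_on {0..1} q" and eq: "\<And>t. t \<in> {0..1} \<Longrightarrow> p t - z = exp (q t)"
  shows "winding_number p z = (q 1 - q 0) / (2 * of_real pi * \<i>)"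
proof -
  have "winding_number p z = winding_number (\<lambda>t. p t - z) 0"
    by (rule winding_number_offset)
  also have "\<dots> = winding_number (exp \<circ> q) 0"
    by (rule winding_number_cong) (simp add: eq)
  also have "\<dots> = (q 1 - q 0) / (2 * of_real pi * \<i>)"
    using winding_number_compose_exp[of q] assms(1)
    by (simp add: path_def pathstart_def pathfinish_def)
  finally show ?thesis .
qed

text \<open>The two sides compute the total change of a logarithm of \<open>q t - p s\<close> along opposite sides of
  the unit square.\<close>

lemma winding_number_exchange:
  assumes p: "path p" and q: "path q" and disj: "path_image p \<inter> path_image q = {}"
  shows "winding_number q (pathfinish p) - winding_number q (pathstart p)
       = winding_number p (pathfinish q) - winding_number p (pathstart q)"
proof -
  let ?S = "{0..1::real} \<times> {0..1::real}"
  have cp: "continuous_on {0..1} p" and cq: "continuous_on {0..1} q"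
    using p q by (auto simp: path_def)
  have cont: "continuous_on ?S (\<lambda>(s, t). q t - p s)"
    unfolding case_prod_beta
    by (intro continuous_intros continuous_on_compose2[OF cp] continuous_on_compose2[OF cq]) auto
  have ne: "(\<lambda>(s, t). q t - p s) z \<noteq> 0" if "z \<in> ?S" for z
    using that disj by (auto simp: path_image_def) (metis IntI atLeastAtMost_iff empty_iff imageI)
  have "contractible ?S"
    by (intro convex_imp_contractible convex_Times) auto
  then obtain g where g: "continuous_on ?S g"
    and geq: "\<And>z. z \<in> ?S \<Longrightarrow> (\<lambda>(s, t). q t - p s) z = exp (g z)"
    using continuous_logarithm_on_contractible[OF cont _ ne] by metis
  have vert: "winding_number q (p s) = (g (s, 1) - g (s, 0)) / (2 * of_real pi * \<i>)"
    if "s \<in> {0..1}" for s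
  proof (rule winding_number_continuous_log)
    show "continuous_on {0..1} (\<lambda>t. g (s, t))"
      using that by (intro continuous_on_compose2[OF g] continuous_intros) auto
    show "q t - p s = exp (g (s, t))" if "t \<in> {0..1}" for t
      using geq[of "(s, t)"] that \<open>s \<in> {0..1}\<close> by simp
  qed
  have horiz: "winding_number p (q t) = (g (1, t) - g (0, t)) / (2 * of_real pi * \<i>)"
    if "t \<in> {0..1}" for t
  proof -
    \<comment> \<open>Since \<open>p s - q t\<close> is the negative of \<open>q t - p s\<close>,
      its logarithm is \<open>g\<close> shifted by half a period; the shift cancels in the
      difference.\<close>
    have "winding_number p (q t)
        = ((g (1, t) + \<i> * pi) - (g (0, t) + \<i> * pi)) / (2 * of_real pi * \<i>)"
    proof (rule winding_number_continuous_log)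
      show "continuous_on {0..1} (\<lambda>s. g (s, t) + \<i> * pi)"
        using that by (intro continuous_on_compose2[OF g] continuous_intros) auto
      show "p s - q t = exp (g (s, t) + \<i> * pi)" if "s \<in> {0..1}" for s
        using geq[of "(s, t)"] that \<open>t \<in> {0..1}\<close> by (simp add: exp_add algebra_simps)
    qed
    then show ?thesis by simp
  qed
  have "winding_number q (p 1) - winding_number q (p 0)
      = winding_number p (q 1) - winding_number p (q 0)"
    by (simp add: vert horiz diff_divide_distrib)
  then show ?thesis by (simp add: pathstart_def pathfinish_def)
qed

lemma no_independent_K5:
  fixes a :: "nat \<Rightarrow> complex" and P :: "nat \<Rightarrow> nat \<Rightarrow> real \<Rightarrow> complex"
  assumes path: "\<And>i j. i < j \<Longrightarrow> j < 5 \<Longrightarrow>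
      path (P i j) \<and> pathstart (P i j) = a i \<and> pathfinish (P i j) = a j"
    and disj: "\<And>i j k l. i < j \<Longrightarrow> j < 5 \<Longrightarrow> k < l \<Longrightarrow> l < 5 \<Longrightarrow> {i, j} \<inter> {k, l} = {} \<Longrightarrow>
      path_image (P i j) \<inter> path_image (P k l) = {}"
  shows False
proof -
  define W where "W i j k = winding_number (P j k) (a i)" for i j k
  define T where "T = 2 * of_real pi * \<i>"
  have T0: "T \<noteq> 0" by (simp add: T_def)
  \<comment> \<open>A vertex \<open>m\<close> outside \<open>{i, j, k}\<close> provides an edge at
    \<open>i\<close> that is independent of the edge \<open>j k\<close>, so their paths are
    disjoint.\<close>
  have notin: "a i \<notin> path_image (P j k)" if "j < k" "k < 5" "i < 5" "i \<noteq> j" "i \<noteq> k" for i j k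
  proof -
    have "\<exists>m\<in>{0,1,2,3::nat}. m \<noteq> i \<and> m \<noteq> j \<and> m \<noteq> k"
      using that by auto
    then obtain m where "m \<in> {0,1,2,3::nat}" and "m \<noteq> i" "m \<noteq> j" "m \<noteq> k" by blast
    then have m: "m < 5" "m \<noteq> i" "m \<noteq> j" "m \<noteq> k" by auto
    show ?thesis
    proof (cases "i < m")
      case True
      then have "a i \<in> path_image (P i m)"
        using path[of i m] m pathstart_in_path_image by metis
      then show ?thesis using disj[of i m j k] True m that by auto
    next
      case False
      then have "m < i" using m by auto
      then have "a i \<in> path_image (P m i)"
        using path[of m i] that pathfinish_in_path_image by metis
      then show ?thesis using disj[of m i j k] \<open>m < i\<close> m that by auto
    qed
  qed
  have ne: "a i \<noteq> a j" if "i < 5" "j < 5" "i \<noteq> j" for i j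
  proof -
    have "\<exists>m\<in>{0,1,2::nat}. m \<noteq> i \<and> m \<noteq> j"
      using that by auto
    then obtain m where "m \<in> {0,1,2::nat}" and "m \<noteq> i" "m \<noteq> j" by blast
    then have m: "m < 5" "m \<noteq> i" "m \<noteq> j" by auto
    show ?thesis
    proof (cases "j < m")
      case True
      then show ?thesis using notin[of j m i] path[of j m] m that pathstart_in_path_image by metis
    next
      case False
      then have "m < j" using m by auto
      then show ?thesis using notin[of m j i] path[of m j] m that pathfinish_in_path_image by metis
    qed
  qed
  \<comment> \<open>\<open>al\<close> measures directions in full turns. Reversing a direction is a
    half turn; building this into \<open>be\<close> makes \<open>be i j - be j i\<close> exactly
    \<open>-1/2\<close> or \<open>1/2\<close>, with no integer ambiguity.\<close>
  define al where "al i j = Ln (a j - a i) / T" for i j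
  define be where "be i j = (if i < j then al i j else al j i + 1 / 2)" for i j
  have expbe: "exp (T * be i j) = a j - a i" if "i < 5" "j < 5" "i \<noteq> j" for i j
  proof (cases "i < j")
    case True
    then show ?thesis using ne[OF that] T0 by (simp add: be_def al_def)
  next
    case False
    have "exp (T * be i j) = exp (Ln (a i - a j) + T / 2)"
      using False T0 by (simp add: be_def al_def distrib_left)
    also have "\<dots> = a j - a i"
      using ne[OF that] by (simp add: exp_add T_def mult.commute[of _ \<i>])
    finally show ?thesis .
  qed
  \<comment> \<open>\<open>exp (T * W i j k)\<close> is the quotient of \<open>a k - a i\<close> by
    \<open>a j - a i\<close>, which determines \<open>W i j k\<close> up to an integer.\<close>
  have W_ex: "\<exists>n::int. W i j k = be i k - be i j + of_int n"
    if "j < k" "k < 5" "i < 5" "i \<noteq> j" "i \<noteq> k" for i j k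
  proof -
    have "exp (T * W i j k) * (a j - a i) = a k - a i"
      using winding_number_exp_2pi[of "P j k" "a i"] path[of j k] notin[OF that] that
      by (simp add: W_def T_def)
    then have "exp (T * W i j k + T * be i j) = exp (T * be i k)"
      using that by (simp add: exp_add expbe)
    then obtain n :: int where "T * W i j k + T * be i j = T * be i k + (of_int (2 * n) * pi) * \<i>"
      by (auto simp: exp_eq)
    then have "T * (W i j k - (be i k - be i j + of_int n)) = 0"
      by (simp add: T_def algebra_simps)
    then show ?thesis using T0 by auto
  qed
  define N where "N i j k = (SOME n::int. W i j k = be i k - be i j + of_int n)" for i j k
  have N: "W i j k = be i k - be i j + of_int (N i j k)"
    if "j < k" "k < 5" "i < 5" "i \<noteq> j" "i \<noteq> k" for i j k
    unfolding N_def using W_ex[OF that] by (rule someI_ex)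
  define s :: "nat \<Rightarrow> nat \<Rightarrow> int" where "s i j = (if i < j then - 1 else 1)" for i j
  have be_s: "be i j - be j i = of_int (s i j) / 2" if "i \<noteq> j" for i j
    using that by (auto simp: be_def s_def)
  \<comment> \<open>After exchanging the roles of the two edges and inserting \<open>N\<close>, the
    directions occur only in differences \<open>be x y - be y x\<close>, which the order of the
    vertices determines.\<close>
  have eq: "s j l - s j k - s i l + s i k = 2 * (N i k l + N l i j - N j k l - N k i j)"
    if "i < j" "j < 5" "k < l" "l < 5" "i \<noteq> k" "i \<noteq> l" "j \<noteq> k" "j \<noteq> l" for i j k l
  proof -
    have "W j k l - W i k l = W l i j - W k i j"
      unfolding W_def
      using winding_number_exchange[of "P i j" "P k l"] path[of i j] path[of k l] disj[of i j k l] that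
      by auto
    then have "(be j l - be l j) - (be j k - be k j) - (be i l - be l i) + (be i k - be k i)
       = of_int (N i k l + N l i j - N j k l - N k i j)"
      using that by (simp add: N algebra_simps)
    moreover have "(of_int (s j l - s j k - s i l + s i k) :: complex)
       = 2 * ((be j l - be l j) - (be j k - be k j) - (be i l - be l i) + (be i k - be k i))"
    proof -
      have "be j l - be l j = of_int (s j l) / 2" "be j k - be k j = of_int (s j k) / 2"
        "be i l - be l i = of_int (s i l) / 2" "be i k - be k i = of_int (s i k) / 2"
        using be_s that by blast+
      then show ?thesis by (simp only:) (simp add: field_simps)
    qed
    ultimately have "(of_int (s j l - s j k - s i l + s i k) :: complex)
       = of_int (2 * (N i k l + N l i j - N j k l - N k i j))"
      by simp
    then show ?thesis by (simp only: of_int_eq_iff)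
  qed
  let ?n = "\<lambda>i j k l. N i k l + N l i j - N j k l - N k i j"
  have par: "even (?n i j k l) \<longleftrightarrow> 4 dvd s j l - s j k - s i l + s i k"
    if "i < j" "j < 5" "k < l" "l < 5" "i \<noteq> k" "i \<noteq> l" "j \<noteq> k" "j \<noteq> l" for i j k l
    unfolding eq[OF that] by presburger
  \<comment> \<open>Among any four vertices exactly one of the three pairings interleaves. Its sign
    sum is \<open>-2\<close>, while nested and separated pairings give \<open>0\<close>; hence five
    odd values and ten even ones.\<close>
  have odd: "odd (?n 0 2 1 3)" "odd (?n 0 2 1 4)" "odd (?n 0 3 1 4)" "odd (?n 0 3 2 4)" "odd (?n 1 3 2 4)"
    by (subst par; simp add: s_def)+
  have even: "even (?n 0 1 2 3)" "even (?n 0 3 1 2)"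
    "even (?n 0 1 2 4)" "even (?n 0 4 1 2)"
    "even (?n 0 1 3 4)" "even (?n 0 4 1 3)"
    "even (?n 0 2 3 4)" "even (?n 0 4 2 3)"
    "even (?n 1 2 3 4)" "even (?n 1 4 2 3)"
    by (subst par; simp add: s_def)+
  let ?sum = "?n 0 2 1 3 + ?n 0 2 1 4 + ?n 0 3 1 4 + ?n 0 3 2 4 + ?n 1 3 2 4
     + (?n 0 1 2 3 + ?n 0 3 1 2 + ?n 0 1 2 4 + ?n 0 4 1 2 + ?n 0 1 3 4 + ?n 0 4 1 3
     + ?n 0 2 3 4 + ?n 0 4 2 3 + ?n 1 2 3 4 + ?n 1 4 2 3)"
  have "odd ?sum"
    using odd even by (simp only: even_add simp_thms)
  \<comment> \<open>The integer for a vertex \<open>i\<close> and an edge \<open>j k\<close> enters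
    through the two edges from \<open>i\<close> to vertices outside \<open>{i, j, k}\<close>; equal
    signs double it, opposite signs cancel it.\<close>
  moreover have "?sum = 2 * (N 0 1 2 + N 0 1 3 + N 0 1 4 + N 0 2 3 + N 0 2 4 + N 0 3 4 + N 3 0 4
     + N 4 0 1 + N 4 0 2 + N 4 0 3 - N 1 0 2 - N 1 0 3 - N 1 0 4 - N 2 0 1 - N 2 1 3 - N 2 1 4
     - N 2 3 4 - N 3 1 2 - N 3 2 4 - N 4 2 3)"
    by (simp only: algebra_simps)
  ultimately show False by simp
qed

section \<open>Independent drawings and contraction\<close>

text \<open>An edge carries one path for each orientation. Edges with a common end may cross arbitrarily;
  this freedom makes the notion stable under contraction.\<close>

definition independent_drawing ::
  "('a \<Rightarrow> 'a \<Rightarrow> bool) \<Rightarrow> ('a \<Rightarrow> complex) \<Rightarrow> ('a \<Rightarrow> 'a \<Rightarrow> real \<Rightarrow> complex) \<Rightarrow> bool" where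
  "independent_drawing E a P \<longleftrightarrow>
     (\<forall>x y. E x y \<longrightarrow> path (P x y) \<and> pathstart (P x y) = a x \<and> pathfinish (P x y) = a y) \<and>
     (\<forall>x y x' y'. E x y \<and> E x' y' \<and> {x, y} \<inter> {x', y'} = {} \<longrightarrow>
        path_image (P x y) \<inter> path_image (P x' y') = {})"

definition independently_drawn :: "('a \<Rightarrow> 'a \<Rightarrow> bool) \<Rightarrow> bool" where
  "independently_drawn E \<longleftrightarrow> (\<exists>a P. independent_drawing E a P)"

lemma independent_drawingD:
  assumes "independent_drawing E a P"
  shows "E x y \<Longrightarrow> path (P x y)" "E x y \<Longrightarrow> pathstart (P x y) = a x"
    "E x y \<Longrightarrow> pathfinish (P x y) = a y"
    "E x y \<Longrightarrow> E x' y' \<Longrightarrow> {x, y} \<inter> {x', y'} = {} \<Longrightarrow>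
        path_image (P x y) \<inter> path_image (P x' y') = {}"
  using assms unfolding independent_drawing_def by blast+

lemma independently_drawn_no_K5:
  assumes "independently_drawn E" and "finite U" "card U = 5"
    and clique: "\<And>x y. x \<in> U \<Longrightarrow> y \<in> U \<Longrightarrow> x \<noteq> y \<Longrightarrow> E x y"
  shows False
proof -
  obtain a P where aP: "independent_drawing E a P"
    using assms(1) unfolding independently_drawn_def by blast
  note P = independent_drawingD(1-3)[OF aP] and disj = independent_drawingD(4)[OF aP]
  obtain f where f: "bij_betw f {..<5::nat} U"
    using ex_bij_betw_nat_finite[OF \<open>finite U\<close>] \<open>card U = 5\<close> by (auto simp: atLeast0LessThan)
  have inj: "f i \<noteq> f j" if "i < 5" "j < 5" "i \<noteq> j" for i j
    using f that by (auto simp: bij_betw_def inj_on_def)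
  have U: "f i \<in> U" if "i < 5" for i
    using f that by (auto simp: bij_betw_def)
  have E: "E (f i) (f j)" if "i < j" "j < 5" for i j
    using clique U inj that by auto
  show False
  proof (rule no_independent_K5)
    show "path (P (f i) (f j)) \<and> pathstart (P (f i) (f j)) = a (f i) \<and> pathfinish (P (f i) (f j)) = a (f j)"
      if "i < j" "j < 5" for i j
      using P E that by blast
    show "path_image (P (f i) (f j)) \<inter> path_image (P (f k) (f l)) = {}"
      if "i < j" "j < 5" "k < l" "l < 5" "{i, j} \<inter> {k, l} = {}" for i j k l
    proof (rule disj)
      show "{f i, f j} \<inter> {f k, f l} = {}"
        using that inj[of i k] inj[of i l] inj[of j k] inj[of j l] by auto
    qed (use E that in auto)
  qed
qed

definition contract :: "'a \<Rightarrow> 'a \<Rightarrow> ('a \<Rightarrow> 'a \<Rightarrow> bool) \<Rightarrow> 'a \<Rightarrow> 'a \<Rightarrow> bool" where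
  "contract u v E x y \<longleftrightarrow> x \<noteq> v \<and> y \<noteq> v \<and> x \<noteq> y \<and>
     (E x y \<or> x = u \<and> E v y \<or> y = u \<and> E x v)"

text \<open>A new edge from \<open>u\<close> to a neighbour \<open>y\<close> of \<open>v\<close> is
  routed through \<open>v\<close> along two old edges. Of two independent edges at most one ends at
  \<open>u\<close>, so at most one is rerouted; the other avoids \<open>u\<close> and
  \<open>v\<close> and hence is independent of both old edges.\<close>

lemma independently_drawn_contract:
  assumes "independently_drawn E" and uv: "E u v" "E v u"
  shows "independently_drawn (contract u v E)"
proof -
  obtain a P where aP: "independent_drawing E a P"
    using assms(1) unfolding independently_drawn_def by blast
  note P = independent_drawingD(1-3)[OF aP] and disj = independent_drawingD(4)[OF aP]
  define Q where "Q x y = (if E x y then P x y else if x = u \<and> E v y then P u v +++ P v y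
    else P x v +++ P v u)" for x y
  have Q: "path (Q x y) \<and> pathstart (Q x y) = a x \<and> pathfinish (Q x y) = a y"
    if "contract u v E x y" for x y
    using that uv unfolding contract_def Q_def by (auto simp: P)
  have avoid: "path_image (Q x y) \<inter> Z = {}"
    if xy: "contract u v E x y"
      and Z: "\<And>p q. E p q \<Longrightarrow> p \<in> {x, y, v} \<Longrightarrow> q \<in> {x, y, v} \<Longrightarrow> path_image (P p q) \<inter> Z = {}" for x y Z
  proof -
    consider "E x y" | "\<not> E x y" "x = u" "E v y" | "\<not> E x y" "\<not> (x = u \<and> E v y)" "y = u" "E x v"
      using xy unfolding contract_def by blast
    then show ?thesis
    proof cases
      case 1
      then show ?thesis using Z[of x y] by (simp add: Q_def)
    next
      case 2
      have "path_image (Q x y) = path_image (P u v) \<union> path_image (P v y)"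
        using 2 uv by (simp add: Q_def path_image_join P)
      then show ?thesis using Z[of u v] Z[of v y] 2 uv by (simp add: Int_Un_distrib2)
    next
      case 3
      have "path_image (Q x y) = path_image (P x v) \<union> path_image (P v u)"
        using 3 uv by (simp add: Q_def path_image_join P)
      then show ?thesis using Z[of x v] Z[of v u] 3 uv by (simp add: Int_Un_distrib2)
    qed
  qed
  have disjQ: "path_image (Q x y) \<inter> path_image (Q x' y') = {}"
    if xy: "contract u v E x y" "contract u v E x' y'" "{x, y} \<inter> {x', y'} = {}"
      and "E x' y'" for x y x' y'
  proof -
    have "{p, q} \<inter> {x', y'} = {}" if "p \<in> {x, y, v}" "q \<in> {x, y, v}" for p q
      using xy that by (auto simp: contract_def)
    then have "path_image (Q x y) \<inter> path_image (P x' y') = {}"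
      using xy(1) \<open>E x' y'\<close> by (intro avoid disj)
    then show ?thesis using \<open>E x' y'\<close> by (simp add: Q_def)
  qed
  have "path_image (Q x y) \<inter> path_image (Q x' y') = {}"
    if "contract u v E x y" "contract u v E x' y'" "{x, y} \<inter> {x', y'} = {}" for x y x' y'
  proof (cases "E x' y' \<or> E x y")
    case True
    then show ?thesis
    proof
      assume "E x' y'"
      then show ?thesis using that by (intro disjQ)
    next
      assume "E x y"
      then have "path_image (Q x' y') \<inter> path_image (Q x y) = {}"
        using that by (intro disjQ) (simp_all add: Int_commute)
      then show ?thesis by (simp add: Int_commute)
    qed
  next
    case False
    then show ?thesis using that by (auto simp: contract_def)
  qed
  then show ?thesis using Q unfolding independently_drawn_def independent_drawing_def by blast
qed

section \<open>Edge counts and Mader's bound\<close>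

text \<open>Ordered pairs make \<open>card (arcs V E)\<close> a degree sum: an edge of a symmetric
  relation counts twice, so the bounds below are twice those for edges.\<close>

definition arcs :: "'a set \<Rightarrow> ('a \<Rightarrow> 'a \<Rightarrow> bool) \<Rightarrow> ('a \<times> 'a) set" where
  "arcs V E = {(x, y). x \<in> V \<and> y \<in> V \<and> E x y}"

lemma finite_arcs: "finite V \<Longrightarrow> finite (arcs V E)"
  by (rule finite_subset[of _ "V \<times> V"]) (auto simp: arcs_def)

lemma card_arcs: "finite V \<Longrightarrow> card (arcs V E) = (\<Sum>x\<in>V. card {y \<in> V. E x y})"
proof -
  assume "finite V"
  have "arcs V E = (SIGMA x:V. {y \<in> V. E x y})" by (auto simp: arcs_def)
  then show ?thesis using \<open>finite V\<close> by simp
qed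

text \<open>Contraction destroys the edge \<open>u v\<close> and merges the two edges to each common
  neighbour; every other edge survives. Arcs count each loss twice.\<close>

lemma card_arcs_contract:
  assumes fin: "finite V" and sym: "\<And>x y. E x y \<Longrightarrow> E y x" and irr: "\<And>x. \<not> E x x"
    and uv: "u \<in> V" "v \<in> V" "E u v"
  shows "card (arcs V E) \<le> card (arcs (V - {v}) (contract u v E)) + 2 + 2 * card {w \<in> V. E u w \<and> E v w}"
proof -
  have sc: "E x y \<longleftrightarrow> E y x" for x y using sym by blast
  define A where "A = arcs (V - {v}) E"
  define N where "N = {w \<in> V. E v w}"
  define C where "C = {w \<in> V. E u w \<and> E v w}"
  define Y where "Y = N - C - {u}"
  have finN: "finite N" "finite C" "finite Y" "finite A"
    using fin by (auto simp: N_def C_def Y_def A_def finite_arcs)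
  have "arcs V E \<subseteq> A \<union> {v} \<times> N \<union> N \<times> {v}"
    using irr by (auto simp: sc A_def N_def arcs_def)
  then have "card (arcs V E) \<le> card (A \<union> {v} \<times> N \<union> N \<times> {v})"
    using finN by (intro card_mono) auto
  also have "\<dots> \<le> card A + card ({v} \<times> N) + card (N \<times> {v})"
    by (meson card_Un_le add_le_mono le_refl order_trans)
  finally have 1: "card (arcs V E) \<le> card A + 2 * card N"
    by (simp add: card_cartesian_product)
  have "N \<subseteq> Y \<union> C \<union> {u}" by (auto simp: Y_def)
  then have "card N \<le> card (Y \<union> C \<union> {u})"
    using finN by (intro card_mono) auto
  also have "\<dots> \<le> card Y + card C + card {u}"
    by (meson card_Un_le add_le_mono le_refl order_trans)
  finally have 2: "card N \<le> card Y + card C + 1" by simp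
  have u: "u \<noteq> v" "v \<notin> Y" using uv irr by (auto simp: Y_def N_def)
  \<comment> \<open>Arcs avoiding \<open>v\<close> stay, and the vertices of \<open>Y\<close> become
    new neighbours of \<open>u\<close>, so the three sets are disjoint.\<close>
  have "A \<union> {u} \<times> Y \<union> Y \<times> {u} \<subseteq> arcs (V - {v}) (contract u v E)"
    using u uv irr by (auto simp: sc A_def Y_def N_def arcs_def contract_def)
  then have "card (A \<union> {u} \<times> Y \<union> Y \<times> {u}) \<le> card (arcs (V - {v}) (contract u v E))"
    using fin by (intro card_mono finite_arcs) auto
  moreover have "card (A \<union> {u} \<times> Y \<union> Y \<times> {u}) = card (A \<union> {u} \<times> Y) + card (Y \<times> {u})"
    using finN irr by (intro card_Un_disjoint) (auto simp: sc A_def Y_def N_def C_def arcs_def)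
  moreover have "card (A \<union> {u} \<times> Y) = card A + card ({u} \<times> Y)"
    using finN irr by (intro card_Un_disjoint) (auto simp: sc A_def Y_def N_def C_def arcs_def)
  ultimately have "card A + 2 * card Y \<le> card (arcs (V - {v}) (contract u v E))"
    by (simp add: card_cartesian_product)
  then show ?thesis using 1 2 unfolding C_def by linarith
qed

text \<open>Mader's induction: contract edges with few common neighbours; when there is none left, a
  neighbourhood is dense enough for the next smaller clique, and the vertex joins the apex set \<open>U\<close>.\<close>

lemma independently_drawn_apex_sparse:
  fixes E :: "'a \<Rightarrow> 'a \<Rightarrow> bool"
  assumes "t \<le> 3" and "card U + t = 3" and "finite U"
    and "\<And>x y. x \<in> U \<Longrightarrow> y \<in> U \<Longrightarrow> x \<noteq> y \<Longrightarrow> E x y"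
    and "\<And>x y. x \<in> U \<Longrightarrow> y \<in> V \<Longrightarrow> E x y" and "finite V" "V \<noteq> {}" "U \<inter> V = {}"
    and "independently_drawn E" and "\<And>x y. E x y \<Longrightarrow> E y x" and "\<And>x. \<not> E x x"
  shows "card (arcs V E) < 2 ^ t * card V"
  using assms
proof (induction t arbitrary: U V E)
  \<comment> \<open>The three apices and the ends of any arc in \<open>V\<close> would form a clique
    on five vertices, so there is no arc.\<close>
  case 0
  show ?case
  proof (cases "arcs V E = {}")
    case True
    then show ?thesis using "0.prems"(6,7) by (simp add: card_gt_0_iff)
  next
    case False
    then obtain x y where xy: "x \<in> V" "y \<in> V" "E x y" by (auto simp: arcs_def)
    note clq = "0.prems"(4) and join = "0.prems"(5) and UV = "0.prems"(8) and sym = "0.prems"(10)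
      and irr = "0.prems"(11)
    have "x \<notin> insert y U" "y \<notin> U" using xy UV irr by blast+
    then have card: "card (insert x (insert y U)) = 5" using \<open>finite U\<close> \<open>card U + 0 = 3\<close> by simp
    have xyU: "E y x" "\<And>z. z \<in> U \<Longrightarrow> E z x \<and> E x z \<and> E z y \<and> E y z"
      using xy join sym by metis+
    have False
    proof (rule independently_drawn_no_K5[OF \<open>independently_drawn E\<close> _ card])
      show "E p q" if "p \<in> insert x (insert y U)" "q \<in> insert x (insert y U)" "p \<noteq> q" for p q
        using that xy xyU clq by auto
    qed (use \<open>finite U\<close> in simp)
    then show ?thesis ..
  qed
next
  case (Suc t)
  from Suc.prems show ?case
  proof (induction "card V" arbitrary: V E rule: less_induct)
    case (less V E)
    note clq = less.prems(4) and join = less.prems(5) and fin = less.prems(6)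
      and UV = less.prems(8) and drawn = less.prems(9) and sym = less.prems(10) and irr = less.prems(11)
    show ?case
    proof (cases "\<exists>u\<in>V. \<exists>v\<in>V. E u v \<and> card {w \<in> V. E u w \<and> E v w} < 2 ^ t")
      case True
      then obtain u v where uv: "u \<in> V" "v \<in> V" "E u v"
        and few: "card {w \<in> V. E u w \<and> E v w} < 2 ^ t" by blast
      let ?E = "contract u v E" and ?V = "V - {v}"
      have vU: "v \<notin> U" "u \<notin> U" using uv UV by blast+
      have uv': "u \<noteq> v" using uv irr by blast
      have "card (arcs ?V ?E) < 2 ^ Suc t * card ?V"
      proof (rule less.hyps)
        show "card ?V < card V" using uv fin by (meson card_Diff1_less)
        show "Suc t \<le> 3" "card U + Suc t = 3" "finite U" by fact+
        show "?E x y" if "x \<in> U" "y \<in> U" "x \<noteq> y" for x y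
          using that clq vU unfolding contract_def by blast
        show "?E x y" if "x \<in> U" "y \<in> ?V" for x y
          using that join vU UV unfolding contract_def by blast
        show "finite ?V" "U \<inter> ?V = {}" using fin UV by blast+
        show "?V \<noteq> {}" using uv uv' by blast
        show "independently_drawn ?E"
          by (rule independently_drawn_contract[OF drawn \<open>E u v\<close> sym[OF \<open>E u v\<close>]])
        show "?E y x" if "?E x y" for x y
          using that sym unfolding contract_def by metis
        show "\<not> ?E x x" for x by (simp add: contract_def)
      qed
      \<comment> \<open>With fewer than \<open>2 ^ t\<close> common neighbours the loss is at most
        \<open>2 + 2 * (2 ^ t - 1) = 2 ^ Suc t\<close>, the allowance for one vertex.\<close>
      moreover have "card (arcs V E) \<le> card (arcs ?V ?E) + 2 + 2 * card {w \<in> V. E u w \<and> E v w}"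
        by (rule card_arcs_contract[OF fin sym irr uv])
      moreover have "card V = card ?V + 1"
        using uv fin by (metis Suc_eq_plus1 card_Suc_Diff1)
      ultimately show ?thesis using few by (simp add: algebra_simps)
    next
      case False
      then have many: "card {w \<in> V. E u w \<and> E v w} \<ge> 2 ^ t" if "u \<in> V" "v \<in> V" "E u v" for u v
        using that by (meson not_le)
      show ?thesis
      proof (cases "arcs V E = {}")
        case True
        then show ?thesis using fin \<open>V \<noteq> {}\<close> by (simp add: card_gt_0_iff)
      next
        case False
        then obtain u v where uv: "u \<in> V" "v \<in> V" "E u v" by (auto simp: arcs_def)
        \<comment> \<open>Common neighbours of \<open>u\<close> and \<open>x\<close> are the
          neighbours of \<open>x\<close> inside \<open>W\<close>, so all degrees in \<open>W\<close>
          are at least \<open>2 ^ t\<close>. This contradicts the bound for \<open>t\<close> with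
          \<open>u\<close> as a further apex.\<close>
        define W where "W = {w \<in> V. E u w}"
        have uU: "u \<notin> U" using uv UV by blast
        have finW: "finite W" using fin by (simp add: W_def)
        have "card (arcs W E) < 2 ^ t * card W"
        proof (rule Suc.IH)
          show "t \<le> 3" using \<open>Suc t \<le> 3\<close> by simp
          show "card (insert u U) + t = 3" using \<open>card U + Suc t = 3\<close> \<open>finite U\<close> uU by simp
          show "finite (insert u U)" "finite W" using \<open>finite U\<close> finW by auto
          show "E x y" if "x \<in> insert u U" "y \<in> insert u U" "x \<noteq> y" for x y
            using that clq join[OF _ uv(1)] sym[OF join[OF _ uv(1)]] by blast
          show "E x y" if "x \<in> insert u U" "y \<in> W" for x y
            using that join unfolding W_def by blast
          show "W \<noteq> {}" using uv by (auto simp: W_def)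
          show "insert u U \<inter> W = {}" using UV irr by (auto simp: W_def)
          show "independently_drawn E" "\<And>x y. E x y \<Longrightarrow> E y x" "\<And>x. \<not> E x x" by fact+
        qed
        moreover have "2 ^ t * card W \<le> card (arcs W E)"
        proof -
          have "2 ^ t \<le> card {y \<in> W. E x y}" if "x \<in> W" for x
          proof -
            have "{y \<in> W. E x y} = {w \<in> V. E u w \<and> E x w}" by (auto simp: W_def)
            then show ?thesis using many[of u x] that uv by (simp add: W_def)
          qed
          then have "(\<Sum>x\<in>W. 2 ^ t) \<le> (\<Sum>x\<in>W. card {y \<in> W. E x y})"
            by (intro sum_mono)
          then show ?thesis by (simp add: card_arcs finW mult.commute)
        qed
        ultimately show ?thesis by simp
      qed
    qed
  qed
qed

section \<open>Selection of compatible objects and greedy colouring\<close>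

text \<open>Greedily pick the label \<open>l\<close> for which the number of objects \<open>x\<close> with \<open>l \<in> D x\<close> is smallest relative
  to the number of objects labelled \<open>l\<close>; keep the latter and discard the former.\<close>

lemma exists_large_conflict_free_subset:
  assumes "finite X" and "\<And>x. x \<in> X \<Longrightarrow> finite (D x) \<and> card (D x) \<le> d"
  shows "\<exists>K\<subseteq>X. card X \<le> (d + 1) * card K \<and>
     (\<forall>x\<in>K. \<forall>y\<in>K. lab x \<noteq> lab y \<longrightarrow> \<not> (lab y \<in> D x \<and> lab x \<in> D y))"
  using assms
proof (induction "card X" arbitrary: X rule: less_induct)
  case less
  show ?case
  proof (cases "X = {}")
    case True
    then show ?thesis by auto
  next
    case False
    let ?w = "\<lambda>l. card {x \<in> X. lab x = l}" and ?c = "\<lambda>l. card {x \<in> X. l \<in> D x}"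
    have fin: "finite X" by fact
    \<comment> \<open>Double counting: each object forbids at most \<open>d\<close> labels, so the
      \<open>?c l\<close> sum to at most \<open>d * card X\<close>, which is the sum of the
      \<open>d * ?w l\<close>. Hence some label satisfies
      \<open>?c l \<le> d * ?w l\<close>.\<close>
    have "(\<Sum>l\<in>lab ` X. ?c l) = (\<Sum>l\<in>lab ` X. \<Sum>x\<in>X. if l \<in> D x then 1 else 0)"
      using fin by (simp add: sum.If_cases Int_def)
    also have "\<dots> = (\<Sum>x\<in>X. \<Sum>l\<in>lab ` X. if l \<in> D x then 1 else 0)"
      by (rule sum.swap)
    also have "\<dots> = (\<Sum>x\<in>X. card {l \<in> lab ` X. l \<in> D x})"
      using fin by (simp add: sum.If_cases Int_def)
    also have "\<dots> \<le> (\<Sum>x\<in>X. d)"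
    proof (rule sum_mono)
      fix x assume "x \<in> X"
      then have "finite (D x)" "card (D x) \<le> d" using less.prems by auto
      moreover have "{l \<in> lab ` X. l \<in> D x} \<subseteq> D x" by blast
      ultimately show "card {l \<in> lab ` X. l \<in> D x} \<le> d"
        using card_mono le_trans by blast
    qed
    also have "\<dots> = d * (\<Sum>x\<in>X. 1)" by simp
    also have "\<dots> = (\<Sum>l\<in>lab ` X. d * ?w l)"
      by (subst sum.image_gen[OF fin, of _ lab]) (simp add: sum_distrib_left)
    finally have "(\<Sum>l\<in>lab ` X. ?c l) \<le> (\<Sum>l\<in>lab ` X. d * ?w l)" .
    moreover have "(\<Sum>l\<in>lab ` X. d * ?w l) < (\<Sum>l\<in>lab ` X. ?c l)"
      if "\<And>l. l \<in> lab ` X \<Longrightarrow> d * ?w l < ?c l"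
      using False fin that by (intro sum_strict_mono) simp_all
    ultimately obtain l where l: "l \<in> lab ` X" "?c l \<le> d * ?w l"
      by (meson not_le)
    \<comment> \<open>All objects labelled \<open>l\<close> are kept and the other objects
      forbidding \<open>l\<close> are dropped. A conflict must be mutual, so whatever is selected
      from \<open>X'\<close> is compatible with the label \<open>l\<close>.\<close>
    define X' where "X' = {x \<in> X. lab x \<noteq> l \<and> l \<notin> D x}"
    have "X' \<subset> X" using l(1) by (auto simp: X'_def)
    then have "card X' < card X" using fin by (rule psubset_card_mono[rotated])
    moreover have "finite X'" "\<And>x. x \<in> X' \<Longrightarrow> finite (D x) \<and> card (D x) \<le> d"
      using less.prems by (auto simp: X'_def)
    ultimately have "\<exists>K\<subseteq>X'. card X' \<le> (d + 1) * card K \<and>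
        (\<forall>x\<in>K. \<forall>y\<in>K. lab x \<noteq> lab y \<longrightarrow> \<not> (lab y \<in> D x \<and> lab x \<in> D y))"
      by (rule less.hyps)
    then obtain K where K: "K \<subseteq> X'" "card X' \<le> (d + 1) * card K"
      "\<And>x y. x \<in> K \<Longrightarrow> y \<in> K \<Longrightarrow> lab x \<noteq> lab y \<Longrightarrow> \<not> (lab y \<in> D x \<and> lab x \<in> D y)"
      by blast
    let ?K = "{x \<in> X. lab x = l} \<union> K"
    have finK: "finite K" using K(1) fin by (auto simp: X'_def intro: finite_subset)
    have "card X \<le> card ({x \<in> X. lab x = l} \<union> {x \<in> X. l \<in> D x} \<union> X')"
      using fin by (intro card_mono) (auto simp: X'_def)
    also have "\<dots> \<le> ?w l + ?c l + card X'"
      by (meson card_Un_le add_le_mono le_refl order_trans)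
    also have "\<dots> \<le> (d + 1) * (?w l + card K)"
      using K(2) l(2) by (simp add: algebra_simps)
    also have "?w l + card K = card ?K"
      using fin finK K(1) by (intro card_Un_disjoint[symmetric]) (auto simp: X'_def)
    finally have "card X \<le> (d + 1) * card ?K" .
    moreover have "?K \<subseteq> X" using K(1) by (auto simp: X'_def)
    moreover have "\<not> (lab y \<in> D x \<and> lab x \<in> D y)" if "x \<in> ?K" "y \<in> ?K" "lab x \<noteq> lab y" for x y
    proof -
      have "l \<notin> D z" if "z \<in> K" for z using that K(1) by (auto simp: X'_def)
      then show ?thesis using that K(3) by auto
    qed
    ultimately show ?thesis by (intro exI[of _ ?K]) blast
  qed
qed

text \<open>A vertex with fewer than \<open>c\<close> neighbours is coloured last: its neighbours
  occupy fewer than \<open>c\<close> colours, so one is free.\<close>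

lemma greedy_colouring:
  fixes H :: "'a \<Rightarrow> 'a \<Rightarrow> bool"
  assumes "finite V" and "\<And>S. S \<subseteq> V \<Longrightarrow> S \<noteq> {} \<Longrightarrow> \<exists>x\<in>S. card {y \<in> S. H x y} < c"
    and sym: "\<And>x y. H x y \<Longrightarrow> H y x" and irr: "\<And>x. \<not> H x x"
  shows "\<exists>\<psi> :: 'a \<Rightarrow> nat. (\<forall>x\<in>V. \<psi> x < c) \<and> (\<forall>x\<in>V. \<forall>y\<in>V. H x y \<longrightarrow> \<psi> x \<noteq> \<psi> y)"
  using assms(1,2)
proof (induction "card V" arbitrary: V rule: less_induct)
  case less
  show ?case
  proof (cases "V = {}")
    case True
    then show ?thesis by auto
  next
    case False
    then obtain x where x: "x \<in> V" "card {y \<in> V. H x y} < c" using less.prems(2)[of V] by auto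
    have "card (V - {x}) < card V" using x(1) less.prems(1) by (rule card_Diff1_less[rotated])
    moreover have "finite (V - {x})" using less.prems(1) by simp
    moreover have "\<exists>x\<in>S. card {y \<in> S. H x y} < c" if "S \<subseteq> V - {x}" "S \<noteq> {}" for S
      using less.prems(2)[of S] that by blast
    ultimately have "\<exists>\<psi> :: 'a \<Rightarrow> nat. (\<forall>y\<in>V - {x}. \<psi> y < c) \<and>
        (\<forall>y\<in>V - {x}. \<forall>z\<in>V - {x}. H y z \<longrightarrow> \<psi> y \<noteq> \<psi> z)"
      by (rule less.hyps)
    then obtain \<psi> :: "'a \<Rightarrow> nat" where \<psi>: "\<forall>y\<in>V - {x}. \<psi> y < c"
      "\<forall>y\<in>V - {x}. \<forall>z\<in>V - {x}. H y z \<longrightarrow> \<psi> y \<noteq> \<psi> z"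
      by blast
    have "card (\<psi> ` {y \<in> V. H x y}) < card {..<c}"
      using x(2) card_image_le[of "{y \<in> V. H x y}" \<psi>] less.prems(1) by simp
    moreover have "finite (\<psi> ` {y \<in> V. H x y})" using less.prems(1) by simp
    ultimately have "\<not> {..<c} \<subseteq> \<psi> ` {y \<in> V. H x y}"
      by (meson card_mono not_le)
    then obtain n where n: "n < c" "n \<notin> \<psi> ` {y \<in> V. H x y}" by blast
    have "(\<psi>(x := n)) y \<noteq> (\<psi>(x := n)) z" if "y \<in> V" "z \<in> V" "H y z" for y z
      using that n \<psi>(2) sym[OF that(3)] irr by (cases "y = x"; cases "z = x") auto
    moreover have "\<forall>y\<in>V. (\<psi>(x := n)) y < c" using n \<psi>(1) by simp
    ultimately show ?thesis by (intro exI[of _ "\<psi>(x := n)"]) auto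
  qed
qed

section \<open>From drawings with few crossings to sparse contractions\<close>

text \<open>Moves the drawing to the complex plane, where winding numbers are available, and records
  in \<open>X e\<close> the edges crossing \<open>e\<close>. Forgetting the crossing points can only
  lower their number.\<close>

lemma k_planar_drawing:
  fixes V :: "'a set"
  assumes graph: "simple_graph V E" and "k_planar k V E"
  obtains a :: "'a \<Rightarrow> complex" and P :: "'a \<Rightarrow> 'a \<Rightarrow> real \<Rightarrow> complex" and X :: "'a set \<Rightarrow> 'a set set"
  where "\<And>x y. E x y \<Longrightarrow> path (P x y) \<and> pathstart (P x y) = a x \<and> pathfinish (P x y) = a y"
    and "\<And>x y. E x y \<Longrightarrow> finite (X {x, y}) \<and> card (X {x, y}) \<le> k"
    and "\<And>x y x' y'. E x y \<Longrightarrow> E x' y' \<Longrightarrow> {x, y} \<inter> {x', y'} = {} \<Longrightarrow>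
      path_image (P x y) \<inter> path_image (P x' y') \<noteq> {} \<Longrightarrow> {x', y'} \<in> X {x, y} \<and> {x, y} \<in> X {x', y'}"
proof -
  obtain pos crv where draw: "is_drawing V E pos crv"
    and cr: "\<And>e. e \<in> edges V E \<Longrightarrow> finite (crossings V E crv e) \<and> card (crossings V E crv e) \<le> k"
    using \<open>k_planar k V E\<close> unfolding k_planar_def by blast
  have EV: "x \<in> V \<and> y \<in> V" if "E x y" for x y
    using graph that unfolding simple_graph_def by blast
  have Ee: "{x, y} \<in> edges V E" if "E x y" for x y
    using EV[OF that] that unfolding edges_def by blast
  have inj: "inj_on pos V" using draw unfolding is_drawing_def by blast
  have crv: "arc (crv {x, y}) \<and>
      ((pathstart (crv {x, y}) = pos x \<and> pathfinish (crv {x, y}) = pos y) \<or>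
       (pathstart (crv {x, y}) = pos y \<and> pathfinish (crv {x, y}) = pos x)) \<and>
      path_image (crv {x, y}) \<inter> pos ` V = {pos x, pos y}" if "E x y" for x y
    using draw EV[OF that] that unfolding is_drawing_def by blast
  define h where "h z = of_real (z $ 1) + \<i> * of_real (z $ 2)" for z :: "real^2"
  have cont: "continuous_on A h" for A
    unfolding h_def by (intro continuous_intros)
  have injh: "h z = h z' \<Longrightarrow> z = z'" for z z'
    by (simp add: h_def complex_eq_iff vec_eq_iff forall_2)
  \<comment> \<open>The curve belongs to the unordered pair and may run either way, so it is
    reversed where needed.\<close>
  define P where "P x y = (let g = h \<circ> crv {x, y} in
      if pathstart (crv {x, y}) = pos x then g else reversepath g)" for x y
  define X where "X e = fst ` crossings V E crv e" for e
  have img: "path_image (P x y) = h ` path_image (crv {x, y})" for x y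
    by (simp add: P_def Let_def path_image_compose)
  have 1: "path (P x y) \<and> pathstart (P x y) = h (pos x) \<and> pathfinish (P x y) = h (pos y)"
    if "E x y" for x y
  proof -
    have "path (h \<circ> crv {x, y})"
      using crv[OF that] by (intro path_continuous_image cont arc_imp_path) blast
    then show ?thesis
      using crv[OF that] by (auto simp: P_def Let_def pathstart_compose pathfinish_compose)
  qed
  have 2: "finite (X {x, y}) \<and> card (X {x, y}) \<le> k" if "E x y" for x y
    using cr[OF Ee[OF that]] unfolding X_def by (meson card_image_le finite_imageI le_trans)
  have interior: "z \<in> curve_interior (crv {x, y})"
    if xy: "E x y" and z: "z \<in> path_image (crv {x, y})" "z \<notin> {pos x, pos y}" for x y z
  proof -
    obtain t where t: "t \<in> {0..1}" "z = crv {x, y} t"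
      using z(1) by (auto simp: path_image_def)
    have "t \<noteq> 0" "t \<noteq> 1"
      using crv[OF xy] z(2) t(2) unfolding pathstart_def pathfinish_def by auto
    then show ?thesis using t by (auto simp: curve_interior_def)
  qed
  have 3: "{x', y'} \<in> X {x, y}"
    if E: "E x y" "E x' y'" and dj: "{x, y} \<inter> {x', y'} = {}"
      and meet: "path_image (P x y) \<inter> path_image (P x' y') \<noteq> {}" for x y x' y'
  proof -
    obtain z where z: "z \<in> path_image (crv {x, y})" "z \<in> path_image (crv {x', y'})"
      using meet injh unfolding img by blast
    have posdj: "{pos x, pos y} \<inter> {pos x', pos y'} = {}"
      using dj EV[OF E(1)] EV[OF E(2)] inj by (auto simp: inj_on_def)
    \<comment> \<open>A curve passes through vertices only at its own ends, and independent edges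
      have no common end; a common point is therefore interior to both curves.\<close>
    have "z \<notin> {pos x, pos y}" "z \<notin> {pos x', pos y'}"
      using crv[OF E(1)] crv[OF E(2)] z posdj EV[OF E(1)] EV[OF E(2)] by blast+
    then have "({x', y'}, z) \<in> crossings V E crv {x, y}"
      using interior[OF E(1) z(1)] interior[OF E(2) z(2)] Ee[OF E(2)] dj unfolding crossings_def by auto
    then show ?thesis unfolding X_def by force
  qed
  show ?thesis
  proof (rule that[of P "\<lambda>x. h (pos x)" X])
    fix x y x' y'
    assume "E x y" "E x' y'" "{x, y} \<inter> {x', y'} = {}" "path_image (P x y) \<inter> path_image (P x' y') \<noteq> {}"
    then show "{x', y'} \<in> X {x, y} \<and> {x, y} \<in> X {x', y'}"
      using 3[of x y x' y'] 3[of x' y' x y] by (simp add: Int_commute)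
  qed (use 1 2 in auto)
qed

text \<open>The case of no apex, \<open>t = 3\<close>; as arcs count twice, this means fewer than
  \<open>4 * card S\<close> edges inside \<open>S\<close>.\<close>

lemma independently_drawn_sparse:
  assumes "finite S" "S \<noteq> {}" and "independently_drawn E"
    and "\<And>x y. E x y \<Longrightarrow> E y x" and "\<And>x. \<not> E x x"
  shows "card (arcs S E) < 8 * card S"
  using independently_drawn_apex_sparse[of 3 "{}" E S] assms by simp

text \<open>A pair joined through \<open>v \<notin> S\<close> is drawn along two edges at \<open>v\<close> and labelled \<open>{v}\<close>; a pair
  joined by an edge is labelled by that edge. Two crossing edges then forbid each other's label, so
  a selection of pairs that respects this is independently drawn.\<close>

lemma k_planar_star_contraction_sparse:
  fixes V S :: "'a set" and \<pi> :: "'a \<Rightarrow> 'a"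
  assumes graph: "simple_graph V E" and "k_planar k V E" and S: "S \<subseteq> V" "S \<noteq> {}"
  defines "M x y \<equiv> x \<noteq> y \<and> (E x y \<or> (\<exists>v. v \<notin> S \<and> E v x \<and> E v y \<and> (\<pi> v = x \<or> \<pi> v = y)))"
  shows "card (arcs S M) < 8 * (2 * k + 1) * card S"
proof -
  have sym: "E y x" if "E x y" for x y using graph that unfolding simple_graph_def by blast
  have irr: "\<not> E x x" for x using graph unfolding simple_graph_def by blast
  have finS: "finite S" using graph S unfolding simple_graph_def by (meson finite_subset)
  obtain a :: "'a \<Rightarrow> complex" and P :: "'a \<Rightarrow> 'a \<Rightarrow> real \<Rightarrow> complex" and X :: "'a set \<Rightarrow> 'a set set"
    where P: "\<And>x y. E x y \<Longrightarrow> path (P x y) \<and> pathstart (P x y) = a x \<and> pathfinish (P x y) = a y"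
    and X: "\<And>x y. E x y \<Longrightarrow> finite (X {x, y}) \<and> card (X {x, y}) \<le> k"
    and cross: "\<And>x y x' y'. E x y \<Longrightarrow> E x' y' \<Longrightarrow> {x, y} \<inter> {x', y'} = {} \<Longrightarrow>
      path_image (P x y) \<inter> path_image (P x' y') \<noteq> {} \<Longrightarrow> {x', y'} \<in> X {x, y} \<and> {x, y} \<in> X {x', y'}"
    by (rule k_planar_drawing[OF graph \<open>k_planar k V E\<close>]) (rule that, assumption+)
  define via where "via x y = (SOME v. v \<notin> S \<and> E v x \<and> E v y \<and> (\<pi> v = x \<or> \<pi> v = y))" for x y
  have via: "via x y \<notin> S" "E (via x y) x" "E (via x y) y" "\<pi> (via x y) = x \<or> \<pi> (via x y) = y"
    if "M x y" "\<not> E x y" for x y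
  proof -
    have "\<exists>v. v \<notin> S \<and> E v x \<and> E v y \<and> (\<pi> v = x \<or> \<pi> v = y)" using that unfolding M_def by blast
    from someI_ex[OF this] show "via x y \<notin> S" "E (via x y) x" "E (via x y) y"
      "\<pi> (via x y) = x \<or> \<pi> (via x y) = y"
      unfolding via_def by blast+
  qed
  define Q where "Q x y = (if E x y then P x y else P x (via x y) +++ P (via x y) y)" for x y
  define U where "U = (\<lambda>(x, y). if E x y then {(x, y)} else {(x, via x y), (via x y, y)})"
  \<comment> \<open>Every edge from \<open>S\<close> to a vertex \<open>v\<close> outside
    \<open>S\<close> gets the label \<open>{v}\<close>, shared by all pairs through
    \<open>v\<close>. A crossing edge thus forbids a single label, however many pairs run along
    it.\<close>
  define label where "label f = (if f \<subseteq> S then f else f - S)" for f :: "'a set"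
  define lab where "lab = (\<lambda>(x, y). if E x y then {x, y} else {via x y})"
  define D where "D o' = (\<Union>(p, q)\<in>U o'. label ` X {p, q})" for o' :: "'a \<times> 'a"
  have U: "E p q \<and> label {p, q} = lab (x, y)" if "(x, y) \<in> arcs S M" "(p, q) \<in> U (x, y)" for x y p q
  proof (cases "E x y")
    case True
    then show ?thesis using that by (auto simp: U_def lab_def label_def arcs_def)
  next
    case False
    then have "M x y" "x \<in> S" "y \<in> S" using that by (auto simp: arcs_def)
    note v = via[OF this(1) False]
    then show ?thesis using that False \<open>x \<in> S\<close> \<open>y \<in> S\<close> sym[of _ x]
      by (auto simp: U_def lab_def label_def)
  qed
  \<comment> \<open>A pair runs along at most two edges, each crossed by at most \<open>k\<close>
    others; this gives the factor \<open>2 * k + 1\<close> in the selection.\<close>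
  have D: "finite (D o') \<and> card (D o') \<le> 2 * k" if "o' \<in> arcs S M" for o'
  proof -
    obtain x y where o': "o' = (x, y)" by (cases o')
    have lX: "finite (label ` X {p, q}) \<and> card (label ` X {p, q}) \<le> k" if "(p, q) \<in> U o'" for p q
      using U[of x y p q] X[of p q] that \<open>o' \<in> arcs S M\<close> o'
      by (meson card_image_le finite_imageI le_trans)
    show ?thesis
    proof (cases "E x y")
      case True
      then have "D o' = label ` X {x, y}" "(x, y) \<in> U o'" by (auto simp: D_def U_def o')
      then show ?thesis using lX[of x y] by simp
    next
      case False
      let ?v = "via x y"
      have mem: "(x, ?v) \<in> U o'" "(?v, y) \<in> U o'" using False by (auto simp: U_def o')
      have "D o' = label ` X {x, ?v} \<union> label ` X {?v, y}" using False by (simp add: D_def U_def o')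
      moreover have "card (label ` X {x, ?v} \<union> label ` X {?v, y})
          \<le> card (label ` X {x, ?v}) + card (label ` X {?v, y})" by (rule card_Un_le)
      ultimately show ?thesis using lX[OF mem(1)] lX[OF mem(2)] by simp
    qed
  qed
  have "\<exists>K\<subseteq>arcs S M. card (arcs S M) \<le> (2 * k + 1) * card K \<and>
     (\<forall>p\<in>K. \<forall>q\<in>K. lab p \<noteq> lab q \<longrightarrow> \<not> (lab q \<in> D p \<and> lab p \<in> D q))"
    by (rule exists_large_conflict_free_subset[OF finite_arcs[OF finS] D])
  then obtain K where K: "K \<subseteq> arcs S M" "card (arcs S M) \<le> (2 * k + 1) * card K"
    and KD: "\<And>p q. p \<in> K \<Longrightarrow> q \<in> K \<Longrightarrow> lab p \<noteq> lab q \<Longrightarrow> \<not> (lab q \<in> D p \<and> lab p \<in> D q)"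
    by blast
  have KM: "x \<in> S" "y \<in> S" "M x y" if "(x, y) \<in> K" for x y
    using K(1) that by (auto simp: arcs_def)
  have Q: "path (Q x y) \<and> pathstart (Q x y) = a x \<and> pathfinish (Q x y) = a y"
    if "(x, y) \<in> K" for x y
    using via[OF KM(3)[OF that]] sym P by (cases "E x y") (simp_all add: Q_def)
  have Qimg: "path_image (Q x y) = (\<Union>(p, q)\<in>U (x, y). path_image (P p q))" if "(x, y) \<in> K" for x y
    using via[OF KM(3)[OF that]] sym P
    by (cases "E x y") (simp_all add: Q_def U_def path_image_join)
  have Qdisj: "path_image (Q x y) \<inter> path_image (Q x' y') = {}"
    if xy: "(x, y) \<in> K" "(x', y') \<in> K" and dj: "{x, y} \<inter> {x', y'} = {}" for x y x' y'
  proof -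
    have v: "\<not> E x y \<Longrightarrow> via x y \<notin> S \<and> (\<pi> (via x y) = x \<or> \<pi> (via x y) = y)"
      "\<not> E x' y' \<Longrightarrow> via x' y' \<notin> S \<and> (\<pi> (via x' y') = x' \<or> \<pi> (via x' y') = y')"
      using via[OF KM(3)[OF xy(1)]] via[OF KM(3)[OF xy(2)]] by blast+
    \<comment> \<open>Pairs through the same \<open>v\<close> share the end \<open>\<pi> v\<close>,
      so independent pairs run through different vertices.\<close>
    have vv: "via x y \<noteq> via x' y'" if "\<not> E x y" "\<not> E x' y'"
      using v that dj by auto
    have notin: "via x y \<notin> {x, y, x', y'}" if "\<not> E x y"
      using v(1)[OF that] KM[OF xy(1)] KM[OF xy(2)] by auto
    have notin': "via x' y' \<notin> {x, y, x', y'}" if "\<not> E x' y'"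
      using v(2)[OF that] KM[OF xy(1)] KM[OF xy(2)] by auto
    have "lab (x, y) \<noteq> lab (x', y')"
      using dj vv notin notin' by (auto simp: lab_def doubleton_eq_iff)
    then have KD': "\<not> (lab (x', y') \<in> D (x, y) \<and> lab (x, y) \<in> D (x', y'))"
      by (rule KD[OF xy])
    have "path_image (P p q) \<inter> path_image (P p' q') = {}"
      if pq: "(p, q) \<in> U (x, y)" "(p', q') \<in> U (x', y')" for p q p' q'
    proof (rule ccontr)
      assume meet: "path_image (P p q) \<inter> path_image (P p' q') \<noteq> {}"
      have E: "E p q" "label {p, q} = lab (x, y)" "E p' q'" "label {p', q'} = lab (x', y')"
        using U[OF _ pq(1)] U[OF _ pq(2)] xy K(1) by blast+
      \<comment> \<open>The intermediate vertices lie outside \<open>S\<close> and differ from each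
        other, so the underlying edges are independent too. If they met, each pair would forbid the
        label of the other.\<close>
      have "{p, q} \<inter> {p', q'} = {}"
        using pq dj vv notin notin' by (auto simp: U_def split: if_splits)
      then have "{p', q'} \<in> X {p, q} \<and> {p, q} \<in> X {p', q'}"
        using cross[OF E(1,3)] meet by blast
      then have "lab (x', y') \<in> D (x, y) \<and> lab (x, y) \<in> D (x', y')"
        using pq E(2,4) unfolding D_def by (metis (mono_tags, lifting) UN_iff case_prod_conv imageI)
      then show False using KD' by blast
    qed
    then show ?thesis unfolding Qimg[OF xy(1)] Qimg[OF xy(2)] by blast
  qed
  \<comment> \<open>\<open>K\<close> may contain only one orientation of a pair; \<open>F\<close> is
    its symmetric closure, drawn with reversed paths where needed.\<close>
  define F where "F x y \<longleftrightarrow> (x, y) \<in> K \<or> (y, x) \<in> K" for x y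
  define R where "R x y = (if (x, y) \<in> K then Q x y else reversepath (Q y x))" for x y
  have Rimg: "\<exists>p q. (p, q) \<in> K \<and> {p, q} = {x, y} \<and> path_image (R x y) = path_image (Q p q)"
    if "F x y" for x y
  proof (cases "(x, y) \<in> K")
    case True
    then show ?thesis unfolding R_def by auto
  next
    case False
    then have "(y, x) \<in> K" using that by (simp add: F_def)
    then show ?thesis using False unfolding R_def by (intro exI[of _ y] exI[of _ x]) auto
  qed
  have Rpath: "path (R x y) \<and> pathstart (R x y) = a x \<and> pathfinish (R x y) = a y"
    if "F x y" for x y
    using that Q unfolding F_def R_def by auto
  have Rdisj: "path_image (R x y) \<inter> path_image (R x' y') = {}"
    if "F x y" "F x' y'" "{x, y} \<inter> {x', y'} = {}" for x y x' y'
    using Rimg[OF that(1)] Rimg[OF that(2)] Qdisj that(3) by metis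
  have "independently_drawn F"
    using Rpath Rdisj unfolding independently_drawn_def independent_drawing_def by blast
  moreover have "F y x" if "F x y" for x y using that unfolding F_def by blast
  moreover have "\<not> F x x" for x using KM(3)[of x x] unfolding F_def M_def by blast
  ultimately have F8: "card (arcs S F) < 8 * card S"
    by (intro independently_drawn_sparse finS S)
  have "K \<subseteq> arcs S F" using K(1) by (auto simp: arcs_def F_def)
  then have "card K \<le> card (arcs S F)" by (rule card_mono[OF finite_arcs[OF finS]])
  then have "(2 * k + 1) * card K < (2 * k + 1) * (8 * card S)"
    using F8 by (intro mult_strict_left_mono) auto
  then show ?thesis using K(2) by (simp add: algebra_simps)
qed

section \<open>Degeneracy of the auxiliary graph and the colouring\<close>

theorem theorem2:
  fixes V :: "'a set" and E :: "'a \<Rightarrow> 'a \<Rightarrow> bool" and k :: nat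
  assumes "simple_graph V E" and "k_planar k V E"
  shows "chi_pcf V E \<le> 60 * k + 59"
proof -
  have EV: "x \<in> V \<and> y \<in> V" if "E x y" for x y
    using assms(1) that unfolding simple_graph_def by blast
  have sym: "E y x" if "E x y" for x y using assms(1) that unfolding simple_graph_def by blast
  have irr: "\<not> E x x" for x using assms(1) unfolding simple_graph_def by blast
  have finV: "finite V" using assms(1) unfolding simple_graph_def by blast
  \<comment> \<open>At an isolated vertex the value is arbitrary; \<open>\<pi> v\<close> is
    consulted only when \<open>v\<close> has a neighbour.\<close>
  define \<pi> where "\<pi> v = (SOME w. E v w)" for v
  have \<pi>: "E v (\<pi> v)" if "E v w" for v w
    unfolding \<pi>_def using that by (rule someI)
  define H where "H x y \<longleftrightarrow> x \<noteq> y \<and> (E x y \<or> (\<exists>v. E v x \<and> E v y \<and> (\<pi> v = x \<or> \<pi> v = y)))" for x y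
  have "\<exists>x\<in>S. card {y \<in> S. H x y} < 60 * k + 59" if S: "S \<subseteq> V" "S \<noteq> {}" for S
  proof -
    define M where "M x y \<longleftrightarrow> x \<noteq> y \<and> (E x y \<or> (\<exists>v. v \<notin> S \<and> E v x \<and> E v y \<and> (\<pi> v = x \<or> \<pi> v = y)))" for x y
    have finS: "finite S" using S finV finite_subset by blast
    have M: "card (arcs S M) < 8 * (2 * k + 1) * card S"
      unfolding M_def by (rule k_planar_star_contraction_sparse[OF assms S])
    \<comment> \<open>An edge of \<open>H\<close> witnessed by some \<open>v\<close> in
      \<open>S\<close> joins \<open>\<pi> v\<close> to some \<open>y\<close> with
      \<open>E v y\<close>, so its two orientations are images of the arc
      \<open>(v, y)\<close>.\<close>
    let ?f = "\<lambda>(v, y). (\<pi> v, y)" and ?g = "\<lambda>(v, y). (y, \<pi> v)"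
    have "p \<in> arcs S M \<union> ?f ` arcs S E \<union> ?g ` arcs S E" if p: "p \<in> arcs S H" for p
    proof -
      obtain x y where xy: "p = (x, y)" "x \<in> S" "y \<in> S" "H x y" using p by (auto simp: arcs_def)
      show ?thesis
      proof (cases "M x y")
        case True
        then show ?thesis using xy by (simp add: arcs_def)
      next
        case False
        then obtain v where v: "v \<in> S" "E v x" "E v y" "\<pi> v = x \<or> \<pi> v = y"
          using \<open>H x y\<close> unfolding H_def M_def by blast
        then have "(v, x) \<in> arcs S E" "(v, y) \<in> arcs S E" using xy by (auto simp: arcs_def)
        then show ?thesis using v(4) xy(1) by force
      qed
    qed
    then have "card (arcs S H) \<le> card (arcs S M \<union> ?f ` arcs S E \<union> ?g ` arcs S E)"
      using finS by (intro card_mono) (auto simp: finite_arcs)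
    also have "\<dots> \<le> card (arcs S M) + card (?f ` arcs S E) + card (?g ` arcs S E)"
      by (meson card_Un_le add_le_mono le_refl order_trans)
    also have "\<dots> \<le> card (arcs S M) + card (arcs S E) + card (arcs S E)"
      using finS by (intro add_mono card_image_le finite_arcs) auto
    also have "\<dots> \<le> 3 * card (arcs S M)"
    proof -
      have "arcs S E \<subseteq> arcs S M" using irr by (auto simp: arcs_def M_def)
      then have "card (arcs S E) \<le> card (arcs S M)" by (rule card_mono[OF finite_arcs[OF finS]])
      then show ?thesis by simp
    qed
    \<comment> \<open>The constant is \<open>3 * 8 * (2 * k + 1)\<close>: one share for
      \<open>M\<close> and two for the arcs inside \<open>S\<close>.\<close>
    also have "\<dots> < (48 * k + 24) * card S" using M by (simp add: algebra_simps)
    also have "\<dots> \<le> (60 * k + 59) * card S" by (intro mult_right_mono) auto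
    finally have "card (arcs S H) < (60 * k + 59) * card S" .
    then have "(\<Sum>x\<in>S. card {y \<in> S. H x y}) < (\<Sum>x\<in>S. 60 * k + 59)"
      by (simp add: card_arcs[OF finS] mult.commute)
    then show ?thesis by (meson not_le sum_mono)
  qed
  moreover have "H y x" if "H x y" for x y
    using that sym unfolding H_def by blast
  moreover have "\<not> H x x" for x by (simp add: H_def)
  ultimately have "\<exists>\<psi> :: 'a \<Rightarrow> nat. (\<forall>x\<in>V. \<psi> x < 60 * k + 59) \<and>
      (\<forall>x\<in>V. \<forall>y\<in>V. H x y \<longrightarrow> \<psi> x \<noteq> \<psi> y)"
    by (rule greedy_colouring[OF finV])
  then obtain \<psi> :: "'a \<Rightarrow> nat" where less: "\<And>x. x \<in> V \<Longrightarrow> \<psi> x < 60 * k + 59"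
    and col: "\<And>x y. x \<in> V \<Longrightarrow> y \<in> V \<Longrightarrow> H x y \<Longrightarrow> \<psi> x \<noteq> \<psi> y"
    by blast
  have "card (\<psi> ` V) \<le> card {..<60 * k + 59}"
    using less by (intro card_mono) auto
  moreover have "proper_colouring V E \<psi>"
    unfolding proper_colouring_def
  proof (intro allI impI)
    fix u v assume "u \<in> V \<and> v \<in> V \<and> E u v"
    then show "\<psi> u \<noteq> \<psi> v" using irr by (intro col) (auto simp: H_def)
  qed
  moreover have "conflict_free V E \<psi>"
    unfolding conflict_free_def
  proof (intro ballI impI)
    fix v assume "nbhd V E v \<noteq> {}"
    then have E\<pi>: "E v (\<pi> v)" using \<pi> by (auto simp: nbhd_def)
    \<comment> \<open>Every other neighbour of \<open>v\<close> is adjacent to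
      \<open>\<pi> v\<close> in \<open>H\<close>, so the colour of \<open>\<pi> v\<close> occurs
      exactly once around \<open>v\<close>.\<close>
    have "w = \<pi> v" if "E v w" "\<psi> w = \<psi> (\<pi> v)" for w
    proof (rule ccontr)
      assume "w \<noteq> \<pi> v"
      then have "H w (\<pi> v)" using that(1) E\<pi> unfolding H_def by blast
      then show False using col[of w "\<pi> v"] EV[OF that(1)] EV[OF E\<pi>] that(2) by blast
    qed
    then have "{w \<in> nbhd V E v. \<psi> w = \<psi> (\<pi> v)} = {\<pi> v}"
      using E\<pi> EV[OF E\<pi>] by (auto simp: nbhd_def)
    then show "\<exists>\<alpha>. card {w \<in> nbhd V E v. \<psi> w = \<alpha>} = 1"
      by (intro exI[of _ "\<psi> (\<pi> v)"]) simp
  qed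
  ultimately have "pcf_colouring V E (60 * k + 59) \<psi>"
    unfolding pcf_colouring_def by simp
  then show ?thesis
    unfolding chi_pcf_def by (intro Least_le exI)
qed

end
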